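(* A connected graph $G$ is randomly internally matchable if and only if $G\cong K_{2n}$ for some $n\ge 1$, or $G\cong K_{n,n}$ for some $n\ge 1$, or $G$ is a leaf extension of some graph.
   Context: All graphs are finite, simple and non-null. An internal vertex is a vertex of degree at least two. A matching is a perfect internal matching if it saturates every internal vertex. A graph is randomly internally matchable if every inclusion-maximal matching is a perfect internal matching. A leaf extension of a graph $G'$ is any graph obtained from $G'$ by adding, for each vertex $v\in V(G')$, a non-empty set $L_v$ of pairwise non-adjacent new vertices each joined by an edge to $v$ only (the sets $L_v$ being pairwise disjoint).
   Formalization: The graph G is additionally assumed to have at least one edge, which excludes exactly K_1: it is connected and randomly internally matchable (no internal vertex) but is neither K_{2n}, nor K_{n,n} with n ≥ 1, nor a leaf extension of a non-null graph. *)

theory Defs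
  imports "Graph_Theory.Graph_Theory" "HOL-Library.Disjoint_Sets"
begin

text \<open>
  A finite simple graph is a \<^locale>\<open>pair_graph\<close>: a finite, loopless, symmetric set of arcs.  Each
  undirected edge is a pair of opposite arcs, so \<^const>\<open>out_degree\<close> is the degree of a vertex.  The
  library predicates \<open>K\<^bsub>m\<^esub>\<close> and \<open>K\<^bsub>m,n\<^esub>\<close> say that a graph is isomorphic to the complete, resp.
  complete bipartite, graph.
\<close>

definition edges :: "'a pair_pre_digraph \<Rightarrow> 'a set set" where
  "edges G = {{u, v} | u v. (u, v) \<in> parcs G}"

definition internal_vertex :: "'a pair_pre_digraph \<Rightarrow> 'a \<Rightarrow> bool" where
  "internal_vertex G v \<longleftrightarrow> v \<in> pverts G \<and> out_degree (with_proj G) v \<ge> 2"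

definition matching :: "'a pair_pre_digraph \<Rightarrow> 'a set set \<Rightarrow> bool" where
  "matching G M \<longleftrightarrow> M \<subseteq> edges G \<and> disjoint M"

definition maximal_matching :: "'a pair_pre_digraph \<Rightarrow> 'a set set \<Rightarrow> bool" where
  "maximal_matching G M \<longleftrightarrow> matching G M \<and> (\<forall>M'. matching G M' \<and> M \<subseteq> M' \<longrightarrow> M' = M)"

definition saturates :: "'a set set \<Rightarrow> 'a \<Rightarrow> bool" where
  "saturates M v \<longleftrightarrow> (\<exists>e\<in>M. v \<in> e)"

definition perfect_internal_matching :: "'a pair_pre_digraph \<Rightarrow> 'a set set \<Rightarrow> bool" where
  "perfect_internal_matching G M \<longleftrightarrow>
     matching G M \<and> (\<forall>v. internal_vertex G v \<longrightarrow> saturates M v)"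

definition randomly_internally_matchable :: "'a pair_pre_digraph \<Rightarrow> bool" where
  "randomly_internally_matchable G \<longleftrightarrow>
     (\<forall>M. maximal_matching G M \<longrightarrow> perfect_internal_matching G M)"

definition leaf_extension :: "'a pair_pre_digraph \<Rightarrow> 'a pair_pre_digraph \<Rightarrow> bool" where
  "leaf_extension G' G \<longleftrightarrow>
     (\<exists>L. (\<forall>v\<in>pverts G'. finite (L v) \<and> L v \<noteq> {} \<and> L v \<inter> pverts G' = {}) \<and>
          disjoint_family_on L (pverts G') \<and>
          pverts G = pverts G' \<union> (\<Union>v\<in>pverts G'. L v) \<and>
          parcs G = parcs G' \<union> (\<Union>v\<in>pverts G'. {v} \<times> L v \<union> L v \<times> {v}))"

text \<open>
  The one-vertex graph is connected and, having no internal vertex, randomly internally matchable,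
  but it is neither complete of even order, nor some \<open>K\<^bsub>n,n\<^esub>\<close> with \<open>n \<ge> 1\<close>, nor a leaf extension.
  So the classification needs a graph with at least one edge.  The base graph of a leaf extension
  may be edgeless: stars are the leaf extensions of a single vertex.
\<close>

lemma one_vertex_graph:
  fixes a :: 'a
  defines "G \<equiv> \<lparr>pverts = {a}, parcs = {}\<rparr>"
  shows "pair_graph G"
    and "Digraph_Component.connected (with_proj G)"
    and "randomly_internally_matchable G"
    and "\<not> (\<exists>n\<ge>1. K\<^bsub>2 * n\<^esub> (with_proj G))"
    and "\<not> (\<exists>n\<ge>1. K\<^bsub>n,n\<^esub> (with_proj G))"
    and "\<not> (\<exists>G'. pair_graph G' \<and> pverts G' \<noteq> {} \<and> leaf_extension G' G)"
proof -
  show "pair_graph G"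
    unfolding G_def by unfold_locales (auto simp: symmetric_def sym_def)
  show "Digraph_Component.connected (with_proj G)"
    unfolding G_def Digraph_Component.connected_def strongly_connected_def mk_symmetric_def
      reachable_def by auto
  show "randomly_internally_matchable G"
    unfolding G_def randomly_internally_matchable_def perfect_internal_matching_def
      maximal_matching_def internal_vertex_def out_degree_def out_arcs_def by auto
  show "\<not> (\<exists>n\<ge>1. K\<^bsub>2 * n\<^esub> (with_proj G))"
    unfolding G_def complete_digraph_def by auto
  show "\<not> (\<exists>n\<ge>1. K\<^bsub>n,n\<^esub> (with_proj G))"
  proof safe
    fix n :: nat
    assume n: "n \<ge> 1" and "K\<^bsub>n,n\<^esub> (with_proj G)"
    then obtain U V where UV: "U \<inter> V = {}" "card U = n" "card V = n" "{} = U \<times> V \<union> V \<times> U"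
      unfolding G_def complete_bipartite_digraph_pair_def by auto
    from UV(4) have "U = {} \<or> V = {}" by auto
    with UV n show False by auto
  qed
  show "\<not> (\<exists>G'. pair_graph G' \<and> pverts G' \<noteq> {} \<and> leaf_extension G' G)"
  proof safe
    fix G' :: "'a pair_pre_digraph" and v
    assume v: "v \<in> pverts G'" and "leaf_extension G' G"
    then obtain L where L: "\<forall>v\<in>pverts G'. L v \<noteq> {} \<and> L v \<inter> pverts G' = {}"
      and "pverts G = pverts G' \<union> (\<Union>v\<in>pverts G'. L v)"
      unfolding leaf_extension_def by auto
    with v have "v = a" "L v \<subseteq> {a}" unfolding G_def by auto
    with L v show "v \<in> {}" by auto
  qed
qed

end

theory Submission
  imports Defs
begin

text \<open>
  In a randomly internally matchable graph, every matching that misses an internal vertex also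
  misses one of its neighbours, since it extends to a maximal matching.  Everything follows by
  swapping edges of a maximal matching.

  If all vertices are internal, replacing the edges \<open>ab, cd\<close> of a perfect matching by \<open>bc\<close> shows
  that every path \<open>a b c d\<close> closes to a 4-cycle.  With a triangle, a maximal clique then absorbs all
  its neighbours; without one, the neighbourhood of any vertex is one side of a complete bipartite
  graph.  A perfect matching gives the parity, respectively the balance.

  If there is a leaf, suppose that an internal vertex \<open>u\<close> with a leaf \<open>l\<close> is adjacent to an internal
  vertex \<open>w\<close> without leaves, and let \<open>w x\<close> be in a maximal matching containing \<open>u l\<close>.  Either \<open>x\<close> has
  an unsaturated neighbour \<open>y\<close>, and replacing \<open>w x\<close> by \<open>x y\<close> strands \<open>w\<close>, or replacing \<open>u l, w x\<close> by
  \<open>u w\<close> strands \<open>x\<close>.  By connectivity, every internal vertex has a leaf.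
\<close>

section \<open>Counting over disjoint sets and closing paths on four vertices\<close>

text \<open>Serves two counts for a matching: \<open>U = UNIV\<close>, \<open>k = 2\<close> gives
  the number of covered vertices, and a side \<open>U\<close> of a bipartition with
  \<open>k = 1\<close> gives the balance.\<close>

lemma card_Union_Int_disjoint:
  assumes "finite M" "disjoint M" "\<And>e. e \<in> M \<Longrightarrow> finite e" "\<And>e. e \<in> M \<Longrightarrow> card (e \<inter> U) = k"
  shows "card (\<Union>M \<inter> U) = k * card M"
proof -
  have "card (\<Union>M \<inter> U) = card (\<Union>e\<in>M. e \<inter> U)"
    by (rule arg_cong[of _ _ card]) auto
  also have "\<dots> = (\<Sum>e\<in>M. card (e \<inter> U))"
    using assms(1,3) disjointD[OF assms(2)] by (intro card_UN_disjoint) blast+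
  finally show ?thesis
    using assms(4) by simp
qed

text \<open>The three inequalities make \<open>a\<close>, \<open>b\<close>, \<open>c\<close>,
  \<open>d\<close> a path on four distinct vertices, since consecutive vertices already differ in a
  loopless graph.\<close>

definition path4_closed :: "'a pair_pre_digraph \<Rightarrow> bool" where
  "path4_closed G \<longleftrightarrow> (\<forall>a b c d. (a, b) \<in> parcs G \<and> (b, c) \<in> parcs G \<and> (c, d) \<in> parcs G \<and>
     a \<noteq> c \<and> a \<noteq> d \<and> b \<noteq> d \<longrightarrow> (a, d) \<in> parcs G)"

lemma path4_closedD:
  "\<lbrakk>path4_closed G; (a, b) \<in> parcs G; (b, c) \<in> parcs G; (c, d) \<in> parcs G; a \<noteq> c; a \<noteq> d; b \<noteq> d\<rbrakk>
    \<Longrightarrow> (a, d) \<in> parcs G"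
  unfolding path4_closed_def by blast

context pair_graph
begin

section \<open>Arcs, edges and matchings\<close>

lemma arc_sym: "(u, v) \<in> parcs G \<Longrightarrow> (v, u) \<in> parcs G"
  using pair_sym_arcs by (auto simp: symmetric_def sym_def)

lemma arc_neq: "(u, v) \<in> parcs G \<Longrightarrow> u \<noteq> v"
  using pair_no_loops by force

lemma edge_iff_arc: "{u, v} \<in> edges G \<longleftrightarrow> (u, v) \<in> parcs G"
  by (auto simp: edges_def doubleton_eq_iff dest: arc_sym)

lemma matching_edgeE:
  assumes "matching G M" "e \<in> M" "u \<in> e"
  obtains v where "e = {u, v}" "(u, v) \<in> parcs G"
  using assms by (auto simp: matching_def edges_def dest!: subsetD dest: arc_sym)

lemma finite_edges: "finite (edges G)"
proof -
  have "edges G = (\<lambda>(u, v). {u, v}) ` parcs G"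
    by (force simp: edges_def)
  then show ?thesis
    using pair_finite_arcs by simp
qed

lemma finite_matching: "matching G M \<Longrightarrow> finite M"
  using finite_edges finite_subset by (auto simp: matching_def)

lemma finite_matching_edge: "matching G M \<Longrightarrow> e \<in> M \<Longrightarrow> finite e"
  by (auto simp: matching_def edges_def dest!: subsetD)

lemma matching_Union_subset: "matching G M \<Longrightarrow> \<Union>M \<subseteq> pverts G"
  by (auto simp: matching_def edges_def dest!: subsetD dest: in_arcsD1 in_arcsD2)

lemma card_Union_matching:
  assumes "matching G M"
  shows "card (\<Union>M) = 2 * card M"
proof -
  have "card (e \<inter> UNIV) = 2" if "e \<in> M" for e
  proof -
    have "e \<in> edges G"
      using assms that by (auto simp: matching_def)
    then show ?thesis
      by (auto simp: edges_def dest: arc_neq)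
  qed
  then have "card (\<Union>M \<inter> UNIV) = 2 * card M"
    using assms finite_matching finite_matching_edge
    by (intro card_Union_Int_disjoint) (auto simp: matching_def)
  then show ?thesis by simp
qed

lemma matching_insert:
  assumes "matching G M" "(u, v) \<in> parcs G" "u \<notin> \<Union>M" "v \<notin> \<Union>M"
  shows "matching G (insert {u, v} M)"
  using assms by (auto simp: matching_def edge_iff_arc pairwise_insert disjnt_def)

lemma matching_subset: "matching G M \<Longrightarrow> N \<subseteq> M \<Longrightarrow> matching G N"
  by (auto simp: matching_def intro: pairwise_subset)

lemma matching_Union_Diff:
  assumes "matching G M" "N \<subseteq> M"
  shows "\<Union>(M - N) = \<Union>M - \<Union>N"
  using assms diff_Union_pairwise_disjoint by (metis matching_def)

text \<open>The exchange used throughout: deleting \<open>N\<close> frees exactly its own vertices,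
  so each end of the new edge may be a vertex of \<open>N\<close> or one that \<open>M\<close>
  misses.\<close>

lemma matching_swap:
  assumes "matching G M" "N \<subseteq> M" "(u, v) \<in> parcs G"
    and "u \<notin> \<Union>M - \<Union>N" "v \<notin> \<Union>M - \<Union>N"
  shows "matching G (insert {u, v} (M - N))"
  using assms matching_Union_Diff[OF assms(1,2)] matching_subset[OF assms(1), of "M - N"]
  by (intro matching_insert) auto

lemma matching_extends_to_maximal:
  assumes "matching G M"
  obtains N where "maximal_matching G N" "M \<subseteq> N"
proof -
  have "finite {N. matching G N}"
    by (rule finite_subset[of _ "Pow (edges G)"]) (auto simp: matching_def finite_edges)
  then obtain N where "N \<in> {N. matching G N}" "M \<subseteq> N" "\<forall>N' \<in> {N. matching G N}. N \<subseteq> N' \<longrightarrow> N = N'"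
    using finite_has_maximal2[of "{N. matching G N}" M] assms by blast
  with that show thesis
    by (auto simp: maximal_matching_def)
qed

lemma maximal_matching_hits_arc:
  assumes "maximal_matching G M" "(u, v) \<in> parcs G"
  shows "u \<in> \<Union>M \<or> v \<in> \<Union>M"
proof (rule ccontr)
  assume *: "\<not> ?thesis"
  then have "matching G (insert {u, v} M)"
    using assms by (intro matching_insert) (auto simp: maximal_matching_def)
  then have "insert {u, v} M = M"
    using assms(1) unfolding maximal_matching_def by blast
  then have "{u, v} \<in> M"
    by (metis insertI1)
  with * show False by blast
qed

section \<open>Internal vertices, connectivity and free neighbours\<close>

lemma internal_vertex_iff:
  "internal_vertex G v \<longleftrightarrow> (\<exists>x y. x \<noteq> y \<and> (v, x) \<in> parcs G \<and> (v, y) \<in> parcs G)"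
proof -
  have "out_arcs (with_proj G) v = Pair v ` {x. (v, x) \<in> parcs G}"
    by (auto simp: out_arcs_def)
  then have deg: "out_degree (with_proj G) v = card {x. (v, x) \<in> parcs G}"
    by (simp add: out_degree_def card_image inj_on_def)
  have "finite {x. (v, x) \<in> parcs G}"
    by (rule finite_subset[OF _ pair_finite_verts]) (auto dest: in_arcsD2)
  then have "card {x. (v, x) \<in> parcs G} \<ge> 2 \<longleftrightarrow>
      (\<exists>x y. x \<noteq> y \<and> (v, x) \<in> parcs G \<and> (v, y) \<in> parcs G)"
    using card_le_Suc0_iff_eq[of "{x. (v, x) \<in> parcs G}"]
    by (auto simp: not_less_eq_eq[symmetric] numeral_2_eq_2)
  then show ?thesis
    by (auto simp: internal_vertex_def deg dest: in_arcsD1)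
qed

lemma not_internal_unique_neighbour:
  "\<not> internal_vertex G v \<Longrightarrow> (v, x) \<in> parcs G \<Longrightarrow> (v, y) \<in> parcs G \<Longrightarrow> x = y"
  by (auto simp: internal_vertex_iff)

text \<open>This is how connectivity enters later proofs. As arcs are symmetric, reachability in the
  symmetric closure is reachability in \<open>G\<close>, and induction along it from one element of
  \<open>S\<close> gets to every vertex.\<close>

lemma connected_closed_eq_verts:
  assumes "Digraph_Component.connected (with_proj G)" "S \<subseteq> pverts G" "S \<noteq> {}"
    and closed: "\<And>u v. u \<in> S \<Longrightarrow> (u, v) \<in> parcs G \<Longrightarrow> v \<in> S"
  shows "S = pverts G"
proof -
  obtain s where s: "s \<in> S" using assms by auto
  have "v \<in> S" if "v \<in> pverts G" for v
  proof -
    have "s \<rightarrow>\<^sup>*\<^bsub>with_proj G\<^esub> v"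
      using assms(1,2) s that sym_arcs
      by (auto simp: Digraph_Component.connected_def strongly_connected_def
          reachable_mk_symmetric_eq[OF sym_arcs])
    then show "v \<in> S"
      by (induction rule: reachable_induct) (auto intro: s closed)
  qed
  with assms(2) show ?thesis by auto
qed

text \<open>An isolated vertex would form a closed set, hence the whole graph, leaving no room for
  an arc.\<close>

lemma connected_has_neighbour:
  assumes "Digraph_Component.connected (with_proj G)" "parcs G \<noteq> {}" "v \<in> pverts G"
  obtains u where "(v, u) \<in> parcs G"
proof -
  have "\<exists>u. (v, u) \<in> parcs G"
  proof (rule ccontr)
    assume *: "\<nexists>u. (v, u) \<in> parcs G"
    then have "{v} = pverts G"
      using assms by (intro connected_closed_eq_verts) auto
    moreover obtain a b where "(a, b) \<in> parcs G"
      using assms(2) by auto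
    ultimately have "a = v"
      using in_arcsD1 by blast
    then show False
      using * \<open>(a, b) \<in> parcs G\<close> by blast
  qed
  with that show thesis by auto
qed

lemma maximal_matching_saturates_internal:
  assumes "randomly_internally_matchable G" "maximal_matching G M" "internal_vertex G v"
  shows "v \<in> \<Union>M"
  using assms
  by (auto simp: randomly_internally_matchable_def perfect_internal_matching_def saturates_def)

text \<open>The witness is the partner of \<open>v\<close> in a maximal extension \<open>N\<close>.
  If \<open>M\<close> covered it, two different edges of \<open>N\<close> would meet there.\<close>

lemma free_internal_has_free_neighbour:
  assumes "randomly_internally_matchable G" "matching G M" "internal_vertex G v" "v \<notin> \<Union>M"
  obtains w where "(v, w) \<in> parcs G" "w \<notin> \<Union>M"
proof -
  obtain N where N: "maximal_matching G N" "M \<subseteq> N"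
    using matching_extends_to_maximal[OF assms(2)] .
  then have "matching G N" by (simp add: maximal_matching_def)
  obtain e where e: "e \<in> N" "v \<in> e"
    using maximal_matching_saturates_internal[OF assms(1) N(1) assms(3)] by auto
  obtain w where w: "e = {v, w}" "(v, w) \<in> parcs G"
    using matching_edgeE[OF \<open>matching G N\<close> e] .
  have "w \<notin> \<Union>M"
  proof
    assume "w \<in> \<Union>M"
    then obtain f where "f \<in> M" "w \<in> f" by auto
    moreover from this assms(4) have "f \<noteq> e" using e by auto
    ultimately show False
      using disjointD[of N e f] \<open>matching G N\<close> N(2) e w by (auto simp: matching_def)
  qed
  with w that show thesis by auto
qed

section \<open>The three families are randomly internally matchable\<close>

text \<open>By parity a free vertex never occurs alone, and two free vertices are adjacent, against
  maximality.\<close>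

lemma complete_randomly_internally_matchable:
  assumes "K\<^bsub>2 * n\<^esub> (with_proj G)"
  shows "randomly_internally_matchable G"
proof -
  have V: "card (pverts G) = 2 * n"
    and arcs: "parcs G = {(u, v). (u, v) \<in> pverts G \<times> pverts G \<and> u \<noteq> v}"
    using assms by (simp_all add: complete_digraph_pair_def)
  have "v \<in> \<Union>M" if M: "maximal_matching G M" and v: "v \<in> pverts G" for M v
  proof (rule ccontr)
    assume free: "v \<notin> \<Union>M"
    have m: "matching G M" using M by (simp add: maximal_matching_def)
    have "card (\<Union>M) = 2 * card M"
      by (rule card_Union_matching[OF m])
    then have "card (pverts G - \<Union>M) = 2 * n - 2 * card M"
      using V matching_Union_subset[OF m] finite_subset[OF _ pair_finite_verts]
      by (simp add: card_Diff_subset)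
    then have "pverts G - \<Union>M \<noteq> {v}"
      by (metis card_1_singleton_iff diff_mult_distrib2 dvd_triv_left odd_one One_nat_def)
    then obtain w where "w \<in> pverts G - \<Union>M" "w \<noteq> v"
      using v free by blast
    with v free have "(v, w) \<in> parcs G"
      by (auto simp: arcs)
    then show False
      using maximal_matching_hits_arc[OF M] free \<open>w \<in> _\<close> by blast
  qed
  then show ?thesis
    by (auto simp: randomly_internally_matchable_def perfect_internal_matching_def
        maximal_matching_def internal_vertex_def saturates_def)
qed

text \<open>Each edge has exactly one end in \<open>U\<close>.\<close>

lemma card_matching_bipartite_side:
  assumes "parcs G = U \<times> V \<union> V \<times> U" "U \<inter> V = {}" "matching G M"
  shows "card (\<Union>M \<inter> U) = card M"
proof -
  have "card (e \<inter> U) = 1" if "e \<in> M" for e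
  proof -
    have "e \<in> edges G"
      using assms(3) that by (auto simp: matching_def)
    then obtain u v where "e = {u, v}" "(u, v) \<in> parcs G"
      by (auto simp: edges_def)
    then have "e \<inter> U = {u} \<or> e \<inter> U = {v}"
      using assms(1,2) by auto
    then show ?thesis by auto
  qed
  then have "card (\<Union>M \<inter> U) = 1 * card M"
    using assms(3) finite_matching finite_matching_edge
    by (intro card_Union_Int_disjoint) (auto simp: matching_def)
  then show ?thesis by simp
qed

text \<open>A matching covers equally many vertices on the two sides, so a free vertex on one side
  comes with a free one on the other, and these are adjacent.\<close>

lemma complete_bipartite_randomly_internally_matchable:
  assumes "K\<^bsub>n,n\<^esub> (with_proj G)"
  shows "randomly_internally_matchable G"
proof -
  obtain U V where UV: "pverts G = U \<union> V" "U \<inter> V = {}" "card U = n" "card V = n"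
    and arcs: "parcs G = U \<times> V \<union> V \<times> U"
    using assms by (auto simp: complete_bipartite_digraph_pair_def)
  \<comment> \<open>Stated for an ordered pair of sides \<open>A\<close>, \<open>B\<close>, to be
    applied to \<open>U\<close>, \<open>V\<close> in both orders.\<close>
  have sat: "v \<in> \<Union>M"
    if M: "maximal_matching G M" and v: "v \<in> A" and AB: "parcs G = A \<times> B \<union> B \<times> A" "A \<inter> B = {}"
      "card A = card B" "finite A" "finite B" for M v A B
  proof (rule ccontr)
    assume free: "v \<notin> \<Union>M"
    have m: "matching G M" using M by (simp add: maximal_matching_def)
    have "card (\<Union>M \<inter> A) = card M" "card (\<Union>M \<inter> B) = card M"
      using card_matching_bipartite_side[OF AB(1,2) m] card_matching_bipartite_side[of B A M] AB(1,2) m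
      by auto
    moreover have "card (\<Union>M \<inter> A) < card A"
      using v free AB(4) by (intro psubset_card_mono) auto
    ultimately have "\<not> B \<subseteq> \<Union>M"
      using AB(3) by (metis inf.absorb2 less_irrefl)
    then obtain w where "w \<in> B" "w \<notin> \<Union>M" by auto
    then show False
      using maximal_matching_hits_arc[OF M, of v w] free v AB(1) by auto
  qed
  have "v \<in> \<Union>M" if "maximal_matching G M" "v \<in> pverts G" for M v
    using sat[OF that(1), of v U V] sat[OF that(1), of v V U] that(2) UV arcs pair_finite_verts
    by auto
  then show ?thesis
    by (auto simp: randomly_internally_matchable_def perfect_internal_matching_def
        maximal_matching_def internal_vertex_def saturates_def)
qed

text \<open>A vertex of \<open>L v\<close> can be matched only to \<open>v\<close>. If
  \<open>v\<close> is free, so are its leaves, and an edge to one of them could be added.\<close>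

lemma leaf_extension_randomly_internally_matchable:
  assumes "pair_graph H" "leaf_extension H G"
  shows "randomly_internally_matchable G"
proof -
  interpret H: pair_graph H by fact
  obtain L where L: "\<And>v. v \<in> pverts H \<Longrightarrow> L v \<noteq> {} \<and> L v \<inter> pverts H = {}"
    and disj: "disjoint_family_on L (pverts H)"
    and V: "pverts G = pverts H \<union> (\<Union>v\<in>pverts H. L v)"
    and arcs: "parcs G = parcs H \<union> (\<Union>v\<in>pverts H. {v} \<times> L v \<union> L v \<times> {v})"
    using assms(2) by (auto simp: leaf_extension_def)
  have leaf: "x = v" if "v \<in> pverts H" "l \<in> L v" "(l, x) \<in> parcs G" for v l x
  proof -
    have "l \<notin> pverts H" using L that by auto
    then have "x \<in> pverts H \<and> l \<in> L x"
      using that arcs L H.in_arcsD1 by auto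
    then show ?thesis
      using disj that by (auto simp: disjoint_family_on_def)
  qed
  have "v \<in> \<Union>M" if M: "maximal_matching G M" and v: "internal_vertex G v" for M v
  proof (rule ccontr)
    assume free: "v \<notin> \<Union>M"
    \<comment> \<open>Added vertices have a single neighbour, so an internal vertex lies in the base
      graph.\<close>
    have "v \<in> pverts H"
      using v leaf V unfolding internal_vertex_iff by (metis UN_E UnE in_arcsD1)
    then obtain l where l: "l \<in> L v" "(v, l) \<in> parcs G"
      using L arcs by blast
    then have "l \<in> \<Union>M"
      using maximal_matching_hits_arc[OF M] free by blast
    then obtain e where e: "e \<in> M" "l \<in> e" by auto
    obtain x where "e = {l, x}" "(l, x) \<in> parcs G"
      using matching_edgeE[OF _ e] M by (auto simp: maximal_matching_def)
    then show False
      using leaf[OF \<open>v \<in> pverts H\<close> l(1)] free e by auto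
  qed
  then show ?thesis
    by (auto simp: randomly_internally_matchable_def perfect_internal_matching_def
        maximal_matching_def saturates_def)
qed

section \<open>Graphs in which every vertex is internal\<close>

lemma all_internal_path4_closed:
  assumes rim: "randomly_internally_matchable G"
    and int: "\<And>v. v \<in> pverts G \<Longrightarrow> internal_vertex G v"
  shows "path4_closed G"
  unfolding path4_closed_def
proof (intro allI impI, elim conjE)
  fix a b c d
  assume arcs: "(a, b) \<in> parcs G" "(b, c) \<in> parcs G" "(c, d) \<in> parcs G"
    and neq: "a \<noteq> c" "a \<noteq> d" "b \<noteq> d"
  have "matching G {{a, b}, {c, d}}"
    using arcs neq arc_neq by (auto simp: matching_def edge_iff_arc pairwise_insert disjnt_def)
  then obtain M where M: "maximal_matching G M" "{{a, b}, {c, d}} \<subseteq> M"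
    by (rule matching_extends_to_maximal)
  let ?M = "insert {b, c} (M - {{a, b}, {c, d}})"
  have m: "matching G M" using M by (simp add: maximal_matching_def)
  have m': "matching G ?M"
    using arcs by (intro matching_swap[OF m M(2)]) auto
  have U: "\<Union>?M = {b, c} \<union> (\<Union>M - {a, b, c, d})"
    using matching_Union_Diff[OF m M(2)] by auto
  have "a \<notin> \<Union>?M"
    unfolding U using neq arc_neq[OF arcs(1)] by auto
  then obtain z where z: "(a, z) \<in> parcs G" "z \<notin> \<Union>?M"
    using free_internal_has_free_neighbour[OF rim m' int] in_arcsD1[OF arcs(1)] by blast
  \<comment> \<open>\<open>M\<close> covers all vertices, so after the swap exactly \<open>a\<close>
    and \<open>d\<close> are free, and the free neighbour \<open>z\<close> of \<open>a\<close> has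
    to be \<open>d\<close>.\<close>
  have "z \<in> \<Union>M"
    using maximal_matching_saturates_internal[OF rim M(1) int] in_arcsD2[OF z(1)] by blast
  with z(2) have "z = a \<or> z = d" unfolding U by auto
  with z(1) show "(a, d) \<in> parcs G" using arc_neq by auto
qed

lemma path4_closed_with_triangle_complete:
  assumes conn: "Digraph_Component.connected (with_proj G)"
    and path4: "path4_closed G"
    and tri: "(x, y) \<in> parcs G" "(y, z) \<in> parcs G" "(x, z) \<in> parcs G"
  shows "parcs G = {(u, v). (u, v) \<in> pverts G \<times> pverts G \<and> u \<noteq> v}"
proof -
  define Qs where "Qs = {Q. Q \<subseteq> pverts G \<and> (\<forall>u\<in>Q. \<forall>v\<in>Q. u \<noteq> v \<longrightarrow> (u, v) \<in> parcs G)}"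
  have "finite Qs"
    by (rule finite_subset[of _ "Pow (pverts G)"]) (auto simp: Qs_def pair_finite_verts)
  moreover have "{x, y, z} \<in> Qs"
    using tri by (auto simp: Qs_def dest: in_arcsD1 in_arcsD2 arc_sym)
  ultimately obtain Q where Q: "Q \<in> Qs" "{x, y, z} \<subseteq> Q" and max: "\<forall>P\<in>Qs. Q \<subseteq> P \<longrightarrow> Q = P"
    using finite_has_maximal2[of Qs "{x, y, z}"] by metis
  have clique: "(u, v) \<in> parcs G" if "u \<in> Q" "v \<in> Q" "u \<noteq> v" for u v
    using Q that by (auto simp: Qs_def)
  have "Q = pverts G"
  proof (rule connected_closed_eq_verts[OF conn])
    show "Q \<subseteq> pverts G" "Q \<noteq> {}" using Q by (auto simp: Qs_def)
    fix q w assume q: "q \<in> Q" and w: "(q, w) \<in> parcs G"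
    show "w \<in> Q"
    proof (rule ccontr)
      assume out: "w \<notin> Q"
      have "(w, r) \<in> parcs G" if r: "r \<in> Q" for r
      proof (cases "r = q")
        case True then show ?thesis using arc_sym[OF w] by simp
      next
        case False
        \<comment> \<open>The triangle provides a third clique vertex \<open>s\<close>, and the path
          \<open>w q s r\<close> closes to give the arc from \<open>w\<close> to
          \<open>r\<close>.\<close>
        have "\<exists>s\<in>{x, y, z}. s \<noteq> q \<and> s \<noteq> r"
          using tri arc_neq by (metis insertCI)
        then obtain s where "s \<in> Q" "s \<noteq> q" "s \<noteq> r" using Q(2) by auto
        then show ?thesis
          using False q r out arc_sym[OF w] clique by (intro path4_closedD[OF path4, of w q s r]) auto
      qed
      then have "insert w Q \<in> Qs"
        using Q(1) in_arcsD2[OF w] arc_sym by (auto simp: Qs_def)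
      then show False using max out by blast
    qed
  qed
  then show ?thesis
    using clique by (auto dest: in_arcsD1 in_arcsD2 arc_neq)
qed

text \<open>\<open>A\<close> is the neighbourhood of a vertex \<open>v\<close>, and \<open>B\<close>
  consists of the vertices adjacent to all of \<open>A\<close>. Path closure shows that
  \<open>A \<union> B\<close> is closed under adjacency; the absence of triangles makes both sides
  independent.\<close>

lemma path4_closed_triangle_free_bipartite:
  assumes conn: "Digraph_Component.connected (with_proj G)" and "parcs G \<noteq> {}"
    and path4: "path4_closed G"
    and tri: "\<And>x y z. \<lbrakk>(x, y) \<in> parcs G; (y, z) \<in> parcs G; (x, z) \<in> parcs G\<rbrakk> \<Longrightarrow> False"
  obtains A B where "pverts G = A \<union> B" "A \<inter> B = {}" "parcs G = A \<times> B \<union> B \<times> A"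
proof -
  obtain v a0 where va0: "(v, a0) \<in> parcs G" using assms(2) by auto
  define A where "A = {a. (v, a) \<in> parcs G}"
  define B where "B = {b \<in> pverts G. \<forall>a\<in>A. (b, a) \<in> parcs G}"
  have a0: "a0 \<in> A" and v: "v \<in> B"
    using va0 by (auto simp: A_def B_def dest: in_arcsD1)
  have A: "A \<subseteq> pverts G" by (auto simp: A_def dest: in_arcsD2)
  have AB: "A \<union> B = pverts G"
  proof (rule connected_closed_eq_verts[OF conn])
    show "A \<union> B \<subseteq> pverts G" "A \<union> B \<noteq> {}" using A a0 by (auto simp: B_def)
    fix x y assume x: "x \<in> A \<union> B" and xy: "(x, y) \<in> parcs G"
    show "y \<in> A \<union> B"
    proof (rule ccontr)
      assume out: "y \<notin> A \<union> B"
      with v have "y \<noteq> v" by auto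
      show False
      proof (cases "x \<in> A")
        case True
        \<comment> \<open>The path \<open>y x v a\<close> closes, so a neighbour \<open>y\<close> of
          \<open>x \<in> A\<close> is adjacent to all of \<open>A\<close>.\<close>
        have "(y, a) \<in> parcs G" if "a \<in> A" for a
        proof (cases "a = x")
          case True then show ?thesis using arc_sym[OF xy] by simp
        next
          case False
          then show ?thesis
            using True that out xy \<open>y \<noteq> v\<close> arc_sym
            by (intro path4_closedD[OF path4, of y x v a]) (auto simp: A_def)
        qed
        then show False
          using out in_arcsD2[OF xy] by (auto simp: B_def)
      next
        case False
        \<comment> \<open>If \<open>x\<close> were \<open>v\<close>, then \<open>y\<close> would lie
          in \<open>A\<close> at once. Otherwise the path \<open>y x a0 v\<close> closes and again
          puts \<open>y\<close> in \<open>A\<close>.\<close>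
        then have "x \<in> B" "x \<noteq> v" using x xy out by (auto simp: A_def)
        then have "(y, v) \<in> parcs G"
          using a0 out xy va0 \<open>y \<noteq> v\<close> arc_sym
          by (intro path4_closedD[OF path4, of y x a0 v]) (auto simp: B_def)
        then show False using out arc_sym by (auto simp: A_def)
      qed
    qed
  qed
  have "A \<inter> B = {}" using arc_neq by (auto simp: B_def)
  moreover have "parcs G = A \<times> B \<union> B \<times> A"
  proof -
    \<comment> \<open>An arc inside \<open>A\<close> forms a triangle with \<open>v\<close>, and an
      arc inside \<open>B\<close> forms one with \<open>a0\<close>.\<close>
    have "(x, y) \<notin> parcs G" if "x \<in> A" "y \<in> A" for x y
      using that tri[of v x y] by (auto simp: A_def)
    moreover have "(x, y) \<notin> parcs G" if "x \<in> B" "y \<in> B" for x y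
      using that tri[of x y a0] a0 by (auto simp: B_def)
    moreover have "(x, y) \<in> parcs G" "(y, x) \<in> parcs G" if "x \<in> A" "y \<in> B" for x y
      using that arc_sym by (auto simp: B_def)
    moreover have "parcs G \<subseteq> (A \<union> B) \<times> (A \<union> B)"
      using AB by (auto dest: in_arcsD1 in_arcsD2)
    ultimately show ?thesis by (intro subset_antisym subrelI) blast+
  qed
  ultimately show thesis
    using that[of A B] AB by auto
qed

text \<open>A maximal matching \<open>M\<close> is perfect here, and \<open>n\<close> is
  \<open>card M\<close> in both outcomes.\<close>

lemma all_internal_complete_or_bipartite:
  assumes conn: "Digraph_Component.connected (with_proj G)" and ne: "parcs G \<noteq> {}"
    and rim: "randomly_internally_matchable G"
    and int: "\<And>v. v \<in> pverts G \<Longrightarrow> internal_vertex G v"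
  shows "(\<exists>n\<ge>1. K\<^bsub>2 * n\<^esub> (with_proj G)) \<or> (\<exists>n\<ge>1. K\<^bsub>n,n\<^esub> (with_proj G))"
proof -
  have path4: "path4_closed G"
    using all_internal_path4_closed[OF rim int] .
  have "matching G {}" by (simp add: matching_def)
  then obtain M where M: "maximal_matching G M" using matching_extends_to_maximal by blast
  then have m: "matching G M" by (simp add: maximal_matching_def)
  have UM: "\<Union>M = pverts G"
    using matching_Union_subset[OF m] maximal_matching_saturates_internal[OF rim M int] by blast
  obtain u v where "(u, v) \<in> parcs G" using ne by auto
  then have "M \<noteq> {}" using UM in_arcsD1 by auto
  then have M1: "card M \<ge> 1" using finite_matching[OF m] by (simp add: Suc_leI card_gt_0_iff)
  show ?thesis
  proof (cases "\<exists>x y z. (x, y) \<in> parcs G \<and> (y, z) \<in> parcs G \<and> (x, z) \<in> parcs G")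
    case True
    then have "parcs G = {(u, v). (u, v) \<in> pverts G \<times> pverts G \<and> u \<noteq> v}"
      using path4_closed_with_triangle_complete[OF conn path4] by blast
    then show ?thesis
      using M1 UM card_Union_matching[OF m] pair_finite_verts
      by (auto simp: complete_digraph_pair_def)
  next
    case False
    then obtain A B where AB: "pverts G = A \<union> B" "A \<inter> B = {}" "parcs G = A \<times> B \<union> B \<times> A"
      using path4_closed_triangle_free_bipartite[OF conn ne path4] by metis
    have "card (\<Union>M \<inter> A) = card M" "card (\<Union>M \<inter> B) = card M"
      using card_matching_bipartite_side[OF AB(3,2) m] card_matching_bipartite_side[of B A M] AB(2,3) m
      by auto
    moreover have "\<Union>M \<inter> A = A" "\<Union>M \<inter> B = B" using UM AB(1) by auto
    ultimately have "card A = card M" "card B = card M" by simp_all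
    then have "K\<^bsub>card M,card M\<^esub> (with_proj G)"
      using AB pair_finite_verts unfolding complete_bipartite_digraph_pair_def by blast
    then show ?thesis using M1 by blast
  qed
qed

section \<open>Graphs with both internal and non-internal vertices\<close>

lemma neighbour_of_leaf_bearing_has_leaf:
  assumes rim: "randomly_internally_matchable G"
    and ul: "(u, l) \<in> parcs G" "\<not> internal_vertex G l"
    and uw: "(u, w) \<in> parcs G" "internal_vertex G w"
  shows "\<exists>k. (w, k) \<in> parcs G \<and> \<not> internal_vertex G k"
proof (rule ccontr)
  assume "\<not> ?thesis"
  then have noleaf: "\<And>k. (w, k) \<in> parcs G \<Longrightarrow> internal_vertex G k" by auto
  have "matching G {{u, l}}" using ul by (simp add: matching_def edge_iff_arc)
  then obtain M where M: "maximal_matching G M" "{{u, l}} \<subseteq> M"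
    by (rule matching_extends_to_maximal)
  note sat = maximal_matching_saturates_internal[OF rim M(1)]
  have m: "matching G M" using M by (simp add: maximal_matching_def)
  obtain e where e: "e \<in> M" "w \<in> e" using sat[OF uw(2)] by auto
  obtain x where x: "e = {w, x}" "(w, x) \<in> parcs G" using matching_edgeE[OF m e] .
  have wul: "w \<noteq> u" "w \<noteq> l" using uw ul arc_neq by auto
  with e have "e \<noteq> {u, l}" by auto
  then have xul: "x \<noteq> u" "x \<noteq> l"
    using disjointD[of M e "{u, l}"] m M(2) e x by (auto simp: matching_def)
  have "w \<noteq> x" using arc_neq x by auto
  show False
  proof (cases "\<exists>y. (x, y) \<in> parcs G \<and> y \<notin> \<Union>M")
    case True
    then obtain y where y: "(x, y) \<in> parcs G" "y \<notin> \<Union>M" by auto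
    let ?M = "insert {x, y} (M - {e})"
    have m': "matching G ?M"
      using x e y by (intro matching_swap[OF m]) auto
    have U: "\<Union>?M = {x, y} \<union> (\<Union>M - {w, x})"
      using matching_Union_Diff[OF m, of "{e}"] e x by auto
    have "w \<noteq> y" using y e by auto
    then have "w \<notin> \<Union>?M" unfolding U using \<open>w \<noteq> x\<close> by auto
    then obtain z where z: "(w, z) \<in> parcs G" "z \<notin> \<Union>?M"
      using free_internal_has_free_neighbour[OF rim m' uw(2)] by blast
    \<comment> \<open>All neighbours of \<open>w\<close> are internal, hence covered by
      \<open>M\<close>, and among the vertices covered by \<open>M\<close> the swap frees only
      \<open>w\<close>.\<close>
    then show False
      using sat[OF noleaf[OF z(1)]] arc_neq[OF z(1)] unfolding U by auto
  next
    case False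
    let ?M = "insert {u, w} (M - {{u, l}, e})"
    have sub: "{{u, l}, e} \<subseteq> M" using M(2) e by auto
    have m': "matching G ?M"
      using x uw by (intro matching_swap[OF m sub]) auto
    have U: "\<Union>?M = {u, w} \<union> (\<Union>M - {u, l, w, x})"
      using matching_Union_Diff[OF m sub] x by auto
    have "x \<notin> \<Union>?M" unfolding U using \<open>w \<noteq> x\<close> xul by auto
    then obtain z where z: "(x, z) \<in> parcs G" "z \<notin> \<Union>?M"
      using free_internal_has_free_neighbour[OF rim m' noleaf[OF x(2)]] by blast
    \<comment> \<open>Among the vertices covered by \<open>M\<close> the swap frees only
      \<open>l\<close> and \<open>x\<close>, so \<open>z\<close> is \<open>l\<close>. But the only
      neighbour of \<open>l\<close> is \<open>u\<close>, which differs from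
      \<open>x\<close>.\<close>
    have "z \<in> \<Union>M" using False z(1) by blast
    then have "z = l" using z arc_neq[OF z(1)] unfolding U by auto
    then show False
      using not_internal_unique_neighbour[OF ul(2) arc_sym[OF ul(1)], of x] arc_sym z(1) xul by auto
  qed
qed

text \<open>Two adjacent non-internal vertices would form a whole component, excluding
  \<open>c\<close>.\<close>

lemma leaf_neighbour_internal:
  assumes conn: "Digraph_Component.connected (with_proj G)"
    and int: "internal_vertex G c" and leaf: "\<not> internal_vertex G l" "(l, u) \<in> parcs G"
  shows "internal_vertex G u"
proof (rule ccontr)
  assume nu: "\<not> internal_vertex G u"
  have "{l, u} = pverts G"
    using leaf nu arc_sym[OF leaf(2)] not_internal_unique_neighbour in_arcsD1 in_arcsD2
    by (intro connected_closed_eq_verts[OF conn]) blast+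
  moreover have "c \<in> pverts G" using int by (simp add: internal_vertex_def)
  ultimately show False using int nu leaf(1) by auto
qed

lemma every_internal_has_leaf:
  assumes conn: "Digraph_Component.connected (with_proj G)"
    and rim: "randomly_internally_matchable G"
    and l: "l \<in> pverts G" "\<not> internal_vertex G l"
    and v: "internal_vertex G v"
  shows "\<exists>k. (v, k) \<in> parcs G \<and> \<not> internal_vertex G k"
proof -
  \<comment> \<open>Non-internal vertices belong to \<open>?S\<close> vacuously, so \<open>l\<close>
    makes it non-empty. From a non-internal \<open>s\<close> the step to \<open>t\<close> is
    immediate, as \<open>s\<close> itself is the required neighbour of \<open>t\<close>.\<close>
  let ?S = "{v \<in> pverts G. internal_vertex G v \<longrightarrow> (\<exists>k. (v, k) \<in> parcs G \<and> \<not> internal_vertex G k)}"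
  have "?S = pverts G"
  proof (rule connected_closed_eq_verts[OF conn])
    show "?S \<noteq> {}" using l by auto
    fix s t assume s: "s \<in> ?S" and st: "(s, t) \<in> parcs G"
    show "t \<in> ?S"
    proof (cases "internal_vertex G s")
      case True
      then obtain k where "(s, k) \<in> parcs G" "\<not> internal_vertex G k" using s by auto
      then show ?thesis
        using neighbour_of_leaf_bearing_has_leaf[OF rim _ _ st] in_arcsD2[OF st] by blast
    next
      case False
      then show ?thesis using arc_sym[OF st] in_arcsD2[OF st] by blast
    qed
  qed auto
  then show ?thesis using v by (auto simp: internal_vertex_def)
qed

text \<open>The base graph is the subgraph induced on the internal vertices. Each remaining vertex
  has exactly one neighbour, and that neighbour is internal, so it belongs to exactly one
  \<open>L v\<close>.\<close>

lemma leaf_extensionI: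
  assumes conn: "Digraph_Component.connected (with_proj G)" and ne: "parcs G \<noteq> {}"
    and c: "internal_vertex G c"
    and leaves: "\<And>v. internal_vertex G v \<Longrightarrow> \<exists>k. (v, k) \<in> parcs G \<and> \<not> internal_vertex G k"
  shows "\<exists>H. pair_graph H \<and> pverts H \<noteq> {} \<and> leaf_extension H G"
proof -
  define I where "I = {v. internal_vertex G v}"
  define H where "H = \<lparr>pverts = I, parcs = parcs G \<inter> I \<times> I\<rparr>"
  define L where "L v = {k. (v, k) \<in> parcs G \<and> k \<notin> I}" for v
  have I: "I \<subseteq> pverts G" by (auto simp: I_def internal_vertex_def)
  have sel: "pverts H = I" "parcs H = parcs G \<inter> I \<times> I" by (simp_all add: H_def)
  have "finite I" using I pair_finite_verts finite_subset by blast
  then have "pair_graph H"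
    using pair_finite_arcs arc_neq arc_sym
    by unfold_locales (auto simp: sel symmetric_def intro!: symI)
  moreover have "leaf_extension H G"
    unfolding leaf_extension_def sel
  proof (intro exI[of _ L] conjI ballI)
    fix v assume "v \<in> I"
    show "finite (L v)"
      by (rule finite_subset[OF _ pair_finite_verts]) (auto simp: L_def dest: in_arcsD2)
    show "L v \<noteq> {}" using leaves \<open>v \<in> I\<close> by (auto simp: L_def I_def)
    show "L v \<inter> I = {}" by (auto simp: L_def)
  next
    show "disjoint_family_on L I"
      using not_internal_unique_neighbour arc_sym
      by (fastforce simp: disjoint_family_on_def L_def I_def)
  next
    have "\<exists>u\<in>I. v \<in> L u" if v: "v \<in> pverts G" "v \<notin> I" for v
    proof -
      obtain u where u: "(v, u) \<in> parcs G" using connected_has_neighbour[OF conn ne v(1)] .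
      then have "u \<in> I" using leaf_neighbour_internal[OF conn c] v by (auto simp: I_def)
      then show ?thesis using u v arc_sym by (auto simp: L_def)
    qed
    then show "pverts G = I \<union> (\<Union>v\<in>I. L v)"
      using I by (auto simp: L_def dest: in_arcsD2)
  next
    \<comment> \<open>No arc joins two non-internal vertices, so every arc lies in the base graph or
      joins some \<open>v\<close> to \<open>L v\<close>.\<close>
    have "u \<in> I \<or> v \<in> I" if "(u, v) \<in> parcs G" for u v
      using leaf_neighbour_internal[OF conn c _ that] by (auto simp: I_def)
    then show "parcs G = parcs G \<inter> I \<times> I \<union> (\<Union>v\<in>I. {v} \<times> L v \<union> L v \<times> {v})"
      using arc_sym by (auto simp: L_def) blast+
  qed
  ultimately show ?thesis using c by (intro exI[of _ H]) (auto simp: sel I_def)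
qed

section \<open>The single edge and the classification\<close>

text \<open>The ends of any arc have no further neighbours, so by connectivity they are the whole
  graph.\<close>

lemma no_internal_complete:
  assumes conn: "Digraph_Component.connected (with_proj G)" and ne: "parcs G \<noteq> {}"
    and "\<And>v. \<not> internal_vertex G v"
  shows "K\<^bsub>2 * 1\<^esub> (with_proj G)"
proof -
  obtain u v where uv: "(u, v) \<in> parcs G" using ne by auto
  have "{u, v} = pverts G"
    using assms(3) uv arc_sym[OF uv] not_internal_unique_neighbour in_arcsD1 in_arcsD2
    by (intro connected_closed_eq_verts[OF conn]) blast+
  then have V: "pverts G = {u, v}" by simp
  then have "parcs G = {(x, y). (x, y) \<in> pverts G \<times> pverts G \<and> x \<noteq> y}"
    using uv arc_sym[OF uv] by (auto dest: in_arcsD1 in_arcsD2 arc_neq)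
  then show ?thesis
    using V arc_neq[OF uv] by (simp add: complete_digraph_pair_def)
qed

end

theorem theorem6:
  fixes G :: "'a pair_pre_digraph"
  assumes "pair_graph G"
    and "parcs G \<noteq> {}"
    and "Digraph_Component.connected (with_proj G)"
  shows "randomly_internally_matchable G \<longleftrightarrow>
    (\<exists>n::nat. n \<ge> 1 \<and> K\<^bsub>2 * n\<^esub> (with_proj G)) \<or>
    (\<exists>n::nat. n \<ge> 1 \<and> K\<^bsub>n,n\<^esub> (with_proj G)) \<or>
    (\<exists>G'. pair_graph G' \<and> pverts G' \<noteq> {} \<and> leaf_extension G' G)"
proof -
  interpret pair_graph G by fact
  show ?thesis
  proof
    assume rim: "randomly_internally_matchable G"
    \<comment> \<open>In the mixed case, \<open>l\<close> starts the spread of leaves to all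
      internal vertices, and \<open>c\<close> keeps the base graph non-empty.\<close>
    consider "\<And>v. v \<in> pverts G \<Longrightarrow> internal_vertex G v" | "\<And>v. \<not> internal_vertex G v"
      | l c where "l \<in> pverts G" "\<not> internal_vertex G l" "internal_vertex G c"
      by blast
    then show "(\<exists>n::nat. n \<ge> 1 \<and> K\<^bsub>2 * n\<^esub> (with_proj G)) \<or>
      (\<exists>n::nat. n \<ge> 1 \<and> K\<^bsub>n,n\<^esub> (with_proj G)) \<or>
      (\<exists>G'. pair_graph G' \<and> pverts G' \<noteq> {} \<and> leaf_extension G' G)"
    proof cases
      case 1
      then show ?thesis
        using all_internal_complete_or_bipartite[OF assms(3,2) rim] by blast
    next
      case 2
      then show ?thesis
        using no_internal_complete[OF assms(3,2)] by blast
    next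
      case 3
      then show ?thesis
        using leaf_extensionI[OF assms(3,2) 3(3)] every_internal_has_leaf[OF assms(3) rim 3(1,2)]
        by blast
    qed
  next
    assume "(\<exists>n::nat. n \<ge> 1 \<and> K\<^bsub>2 * n\<^esub> (with_proj G)) \<or>
      (\<exists>n::nat. n \<ge> 1 \<and> K\<^bsub>n,n\<^esub> (with_proj G)) \<or>
      (\<exists>G'. pair_graph G' \<and> pverts G' \<noteq> {} \<and> leaf_extension G' G)"
    then show "randomly_internally_matchable G"
      using complete_randomly_internally_matchable complete_bipartite_randomly_internally_matchable
        leaf_extension_randomly_internally_matchable by blast
  qed
qed

end
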